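(* Let $m\geq 2$ be a positive integer and let $R\cong \prod_{i=1}^{m}R_{i}$, where for every $1\leq i\leq m$, $R_{i}$ is a local Artinian principal ideal ring that is not a field. Assume that it is not the case that $m=2$ and $|I(R_{1})|=|I(R_{2})|=1$. Then $In(R)_{SR}$ is a connected graph.
   Context: All rings are commutative with identity. $I(R)$ denotes the set of non-trivial ideals of $R$ (ideals different from $0$ and $R$). The inclusion ideal graph $In(R)$ is the simple graph with vertex set $I(R)$, two distinct vertices being adjacent if and only if one of them is properly contained in the other. A local Artinian principal ideal ring has only finitely many ideals, and they are totally ordered by inclusion. For a graph $G$ with distance $d$ and open neighborhoods $N(\cdot)$, two different vertices $u,v$ are mutually maximally distant if $d(v,w)\leq d(u,v)$ for every $w\in N(u)$ and $d(u,w)\leq d(u,v)$ for every $w\in N(v)$. The strong resolving graph $G_{SR}$ has as vertices those $u\in V(G)$ for which there is some $v\in V(G)$ such that $u,v$ are mutually maximally distant, and $u,v$ are adjacent in $G_{SR}$ if and only if they are mutually maximally distant in $G$. *)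

theory Defs
  imports "HOL-Algebra.Algebra" "Graph_Theory.Graph_Theory"
begin

definition nontrivial_ideals :: "('a, 'm) ring_scheme \<Rightarrow> 'a set set" where
  "nontrivial_ideals R = {I. ideal I R \<and> I \<noteq> {\<zero>\<^bsub>R\<^esub>} \<and> I \<noteq> carrier R}"

locale local_cring = cring +
  assumes unique_maximalideal: "\<exists>!M. maximalideal M R"

locale artinian_ring = ring +
  assumes descending_chain_condition:
    "(\<And>n. ideal (I n) R) \<Longrightarrow> (\<And>n. I (Suc n) \<subseteq> I n) \<Longrightarrow> \<exists>N::nat. \<forall>n\<ge>N. I n = I N"

locale principal_ideal_ring = cring +
  assumes ideal_principal: "ideal I R \<Longrightarrow> principalideal I R"

locale local_artinian_principal_ideal_ring =
  local_cring + artinian_ring + principal_ideal_ring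

text \<open>
  A simple graph is represented by a symmetric loop-free digraph without parallel arcs:
  the edge between \<open>u\<close> and \<open>v\<close> is the pair of arcs \<open>(u, v)\<close> and \<open>(v, u)\<close>.
\<close>

definition inclusion_ideal_graph :: "('a, 'm) ring_scheme \<Rightarrow> 'a set pair_pre_digraph" where
  "inclusion_ideal_graph R =
     \<lparr> pverts = nontrivial_ideals R,
       parcs = {(I, J). I \<in> nontrivial_ideals R \<and> J \<in> nontrivial_ideals R \<and> (I \<subset> J \<or> J \<subset> I)} \<rparr>"

lemma inclusion_ideal_graph_simple: "pair_bidirected_digraph (inclusion_ideal_graph R)"
  by unfold_locales (auto simp: inclusion_ideal_graph_def symmetric_def intro!: symI)

text \<open>
  The distance is the minimal number of arcs on a walk, and \<open>\<infinity>\<close> if there is no walk.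
\<close>

definition graph_dist :: "'v pair_pre_digraph \<Rightarrow> 'v \<Rightarrow> 'v \<Rightarrow> ereal" where
  "graph_dist G u v = wf_digraph.\<mu> (with_proj G) (\<lambda>_. 1) u v"

definition open_nbhd :: "'v pair_pre_digraph \<Rightarrow> 'v \<Rightarrow> 'v set" where
  "open_nbhd G u = {w \<in> pverts G. (u, w) \<in> parcs G}"

definition mutually_maximally_distant :: "'v pair_pre_digraph \<Rightarrow> 'v \<Rightarrow> 'v \<Rightarrow> bool" where
  "mutually_maximally_distant G u v \<longleftrightarrow>
     u \<in> pverts G \<and> v \<in> pverts G \<and> u \<noteq> v \<and>
     (\<forall>w \<in> open_nbhd G u. graph_dist G v w \<le> graph_dist G u v) \<and>
     (\<forall>w \<in> open_nbhd G v. graph_dist G u w \<le> graph_dist G u v)"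

definition strong_resolving_graph :: "'v pair_pre_digraph \<Rightarrow> 'v pair_pre_digraph" where
  "strong_resolving_graph G =
     \<lparr> pverts = {u \<in> pverts G. \<exists>v \<in> pverts G. mutually_maximally_distant G u v},
       parcs = {(u, v). mutually_maximally_distant G u v} \<rparr>"

end

(*
  The ideals of each factor form a chain: if the maximal ideal is (t), the descending chain condition
  makes t nilpotent, so every nonzero element is a unit times a power of t. Ideals of the product are
  tuples of ideals, so the inclusion ideal graph is the comparability graph of a product of chains with
  bottom and top removed. Call a vertex interior if some coordinate is neither zero nor the whole factor.
  Every vertex is within distance two of an interior one, so incomparable interior vertices are mutually
  maximally distant. Let h be a vertex all of whose coordinates are nontrivial. A non-interior vertex
  is incomparable to h, and all neighbours of h are interior, so it is mutually maximally distant from h.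
  It remains to join interior vertices by chains of incomparable interior vertices: with three factors
  via tuples with one zero, one full and otherwise nontrivial coordinates, and with two factors, one
  of which has nontrivial ideals a < b, via (a, R) and (b, 0).
*)
theory Submission
  imports Defs
begin

section \<open>Distances and connectedness\<close>

context pair_wf_digraph begin

lemma graph_dist_le_length:
  assumes "u \<in> pverts G" "set p \<subseteq> parcs G" "pcas u p v"
  shows "graph_dist G u v \<le> ereal (length p)"
proof -
  have "awalk u p v"
    using assms by (simp add: awalk_def)
  moreover have "awalk_cost (\<lambda>_. 1) p = length p"
    by (induction p) auto
  ultimately show ?thesis
    unfolding graph_dist_def using min_cost_le_walk_cost[of u p v "\<lambda>_. 1"] by simp
qed

text \<open>Allowing \<open>z\<close> to coincide with an endpoint covers paths of length 0, 1 and 2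
  at once. A common lower or upper bound of two vertices can then serve as \<open>z\<close> even if
  it is one of them.\<close>

lemma graph_dist_le_two:
  assumes "u \<in> pverts G" "u = z \<or> (u, z) \<in> parcs G" "z = v \<or> (z, v) \<in> parcs G"
  shows "graph_dist G u v \<le> 2"
proof -
  define p where "p = (if u = z then [] else [(u, z)]) @ (if z = v then [] else [(z, v)])"
  have "graph_dist G u v \<le> ereal (length p)"
    using assms by (intro graph_dist_le_length) (auto simp: p_def)
  also have "\<dots> \<le> 2"
    by (auto simp: p_def)
  finally show ?thesis .
qed

lemma graph_dist_ge_two:
  assumes "u \<noteq> v" "(u, v) \<notin> parcs G"
  shows "2 \<le> graph_dist G u v"
  unfolding graph_dist_def \<mu>_def
proof (rule INF_greatest)
  fix p assume "p \<in> {p. awalk u p v}"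
  then have p: "set p \<subseteq> parcs G" "pcas u p v"
    by (auto simp: awalk_def)
  have "2 \<le> length p"
  proof (rule ccontr)
    assume "\<not> 2 \<le> length p"
    then consider "p = []" | e where "p = [e]"
      by (cases p; cases "tl p") auto
    then show False
      using p assms by cases auto
  qed
  moreover have "awalk_cost (\<lambda>_. 1) p = length p"
    by (induction p) auto
  ultimately show "2 \<le> ereal (awalk_cost (\<lambda>_. 1) p)"
    by simp
qed

end

text \<open>Connectedness of a digraph is strong connectedness of its symmetric closure, so a
  one-way \<open>E\<close>-path from every vertex to the hub \<open>h\<close> suffices: the reversed
  arcs lead back.\<close>

lemma connectedI:
  assumes h: "h \<in> pverts H"
    and reach: "\<And>x. x \<in> pverts H \<Longrightarrow> (x, h) \<in> E\<^sup>*"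
    and E: "\<And>x y. (x, y) \<in> E \<Longrightarrow> (x, y) \<in> parcs H \<and> x \<in> pverts H \<and> y \<in> pverts H"
  shows "Digraph_Component.connected (with_proj H)"
proof -
  let ?K = "mk_symmetric (with_proj H)"
  have verts: "pverts ?K = pverts H" and arcs: "parcs ?K = parcs H \<union> (parcs H)\<inverse>"
    by (auto simp: mk_symmetric_def)
  have r: "(x, h) \<in> rtrancl_on (pverts H) (parcs ?K) \<and> (h, x) \<in> rtrancl_on (pverts H) (parcs ?K)"
    if "(x, h) \<in> E\<^sup>*" for x
    using that
  proof (induction rule: converse_rtrancl_induct)
    case base
    show ?case using h by (simp add: rtrancl_on_refl)
  next
    case (step x y)
    then have "(x, y) \<in> parcs ?K" "(y, x) \<in> parcs ?K" "x \<in> pverts H" "y \<in> pverts H"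
      using E[of x y] arcs by auto
    then show ?case
      using step.IH by (meson converse_rtrancl_on_into_rtrancl_on rtrancl_on_into_rtrancl_on)
  qed
  show ?thesis
    unfolding connected_def strongly_connected_def reachable_def with_proj_simps verts
    using h r[OF reach] by (blast intro: rtrancl_on_trans)
qed

section \<open>Comparability graphs of products of chains\<close>

text \<open>The order on sets is inclusion, so the nontrivial ideals as \<open>V\<close> give the
  inclusion ideal graph.\<close>

definition comparability_graph :: "'p::order set \<Rightarrow> 'p pair_pre_digraph" where
  "comparability_graph V = \<lparr> pverts = V, parcs = {(x, y). x \<in> V \<and> y \<in> V \<and> (x < y \<or> y < x)} \<rparr>"

lemma comparability_graph_wf: "pair_wf_digraph (comparability_graph V)"
  by unfold_locales (auto simp: comparability_graph_def)

text \<open>\<open>le_iff\<close> and \<open>coord_surj\<close> make \<open>L\<close> order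
  isomorphic to the product of the chains \<open>C i\<close> without fixing its elements as tuples.
  The ideals of \<open>R\<close> themselves can then serve as \<open>L\<close>, with their images
  under the projections as coordinates.\<close>

locale chain_product =
  fixes L :: "'p::order set" and A :: "'i set" and C :: "'i \<Rightarrow> 'c::order set"
    and lo mid hi :: "'i \<Rightarrow> 'c" and coord :: "'p \<Rightarrow> 'i \<Rightarrow> 'c"
  assumes coord_mem: "x \<in> L \<Longrightarrow> i \<in> A \<Longrightarrow> coord x i \<in> C i"
    and le_iff: "x \<in> L \<Longrightarrow> y \<in> L \<Longrightarrow> x \<le> y \<longleftrightarrow> (\<forall>i\<in>A. coord x i \<le> coord y i)"
    and coord_surj: "(\<And>i. i \<in> A \<Longrightarrow> f i \<in> C i) \<Longrightarrow> \<exists>x\<in>L. \<forall>i\<in>A. coord x i = f i"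
    and total: "i \<in> A \<Longrightarrow> a \<in> C i \<Longrightarrow> b \<in> C i \<Longrightarrow> a \<le> b \<or> b \<le> a"
    and lo_mem: "i \<in> A \<Longrightarrow> lo i \<in> C i" and lo_le: "i \<in> A \<Longrightarrow> a \<in> C i \<Longrightarrow> lo i \<le> a"
    and hi_mem: "i \<in> A \<Longrightarrow> hi i \<in> C i" and le_hi: "i \<in> A \<Longrightarrow> a \<in> C i \<Longrightarrow> a \<le> hi i"
    and mid_mem: "i \<in> A \<Longrightarrow> mid i \<in> C i" and lo_mid: "i \<in> A \<Longrightarrow> lo i < mid i"
    and mid_hi: "i \<in> A \<Longrightarrow> mid i < hi i"
begin

definition proper :: "'p set" where
  "proper = {x \<in> L. (\<exists>i\<in>A. coord x i \<noteq> lo i) \<and> (\<exists>i\<in>A. coord x i \<noteq> hi i)}"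

definition interior :: "'p set" where
  "interior = {x \<in> L. \<exists>i\<in>A. lo i < coord x i \<and> coord x i < hi i}"

abbreviation G where "G \<equiv> comparability_graph proper"

text \<open>Asking for both orders makes the relation symmetric by construction, so paths can be
  reversed.\<close>

abbreviation mmd :: "('p \<times> 'p) set" where
  "mmd \<equiv> {(x, y). mutually_maximally_distant G x y \<and> mutually_maximally_distant G y x}"

lemma G_simps: "pverts G = proper" "(x, y) \<in> parcs G \<longleftrightarrow> x \<in> proper \<and> y \<in> proper \<and> (x < y \<or> y < x)"
  by (auto simp: comparability_graph_def)

sublocale G: pair_wf_digraph G
  by (rule comparability_graph_wf)

lemma interior_proper: "x \<in> interior \<Longrightarrow> x \<in> proper"
  by (force simp: interior_def proper_def)

lemma proper_L: "x \<in> proper \<Longrightarrow> x \<in> L"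
  by (simp add: proper_def)

lemma lo_less: "x \<in> L \<Longrightarrow> i \<in> A \<Longrightarrow> coord x i \<noteq> lo i \<Longrightarrow> lo i < coord x i"
  using lo_le[OF _ coord_mem] by (simp add: order.not_eq_order_implies_strict)

lemma less_hi: "x \<in> L \<Longrightarrow> i \<in> A \<Longrightarrow> coord x i \<noteq> hi i \<Longrightarrow> coord x i < hi i"
  using le_hi[OF _ coord_mem] by (simp add: order.not_eq_order_implies_strict)

lemma interiorI:
  "x \<in> L \<Longrightarrow> i \<in> A \<Longrightarrow> coord x i \<noteq> lo i \<Longrightarrow> coord x i \<noteq> hi i \<Longrightarrow> x \<in> interior"
  unfolding interior_def using lo_less less_hi by blast

lemma not_leI: "x \<in> L \<Longrightarrow> y \<in> L \<Longrightarrow> i \<in> A \<Longrightarrow> coord x i < coord y i \<Longrightarrow> \<not> y \<le> x"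
  using le_iff by (auto simp: less_le_not_le)

lemma lo_less_hi: "i \<in> A \<Longrightarrow> lo i < hi i"
  using lo_mid mid_hi by (rule less_trans)

section \<open>Distances and mutual maximal distance for interior elements\<close>

text \<open>
  Only Boolean elements, those with every coordinate extremal, have a lattice complement; hence
  interior elements are within distance two of every vertex.
\<close>

lemma interior_common_bound:
  assumes x: "x \<in> interior" and w: "w \<in> proper"
  obtains z where "z \<in> proper" "z \<le> x \<and> z \<le> w \<or> x \<le> z \<and> w \<le> z"
proof -
  obtain i where i: "i \<in> A" "lo i < coord x i" "coord x i < hi i" and L: "x \<in> L" "w \<in> L"
    using x w by (auto simp: interior_def proper_def)
  show thesis
  proof (cases "coord w i = lo i")
    case True
    \<comment> \<open>An upper bound: it agrees with \<open>x\<close> at \<open>i\<close> and is top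
      elsewhere. It lies above \<open>w\<close> because \<open>w\<close> is bottom at
      \<open>i\<close>, and coordinate \<open>i\<close> keeps it interior.\<close>
    have "\<exists>z\<in>L. \<forall>j\<in>A. coord z j = (hi(i := coord x i)) j"
      using hi_mem coord_mem L by (intro coord_surj) auto
    then obtain z where z: "z \<in> L" "\<forall>j\<in>A. coord z j = (hi(i := coord x i)) j"
      by blast
    have "z \<in> interior"
      using i z by (intro interiorI[of _ i]) auto
    moreover have "x \<le> z" "w \<le> z"
      using z L True i by (auto simp: le_iff intro: le_hi coord_mem less_imp_le)
    ultimately show thesis
      using that interior_proper by blast
  next
    case False
    \<comment> \<open>Dually, a lower bound: the smaller of the two coordinates at \<open>i\<close>,
      and bottom elsewhere. It is interior because \<open>w\<close> is not bottom at
      \<open>i\<close>.\<close>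
    define k where "k = (if coord x i \<le> coord w i then coord x i else coord w i)"
    have k: "k \<in> C i" "lo i < k" "k \<le> coord x i" "k \<le> coord w i"
      using i L False total[OF i(1) coord_mem[OF L(1) i(1)] coord_mem[OF L(2) i(1)]]
      by (auto simp: k_def coord_mem lo_less)
    have "\<exists>z\<in>L. \<forall>j\<in>A. coord z j = (lo(i := k)) j"
      using lo_mem k by (intro coord_surj) auto
    then obtain z where z: "z \<in> L" "\<forall>j\<in>A. coord z j = (lo(i := k)) j"
      by blast
    have "z \<in> interior"
      using i z k by (intro interiorI[of _ i]) auto
    moreover have "z \<le> x" "z \<le> w"
      using z L i k by (auto simp: le_iff intro: lo_le coord_mem)
    ultimately show thesis
      using that interior_proper by blast
  qed
qed

lemma interior_dist_le_two:
  assumes "x \<in> interior" "w \<in> proper"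
  shows "graph_dist G x w \<le> 2" "graph_dist G w x \<le> 2"
proof -
  obtain z where z: "z \<in> proper" "z \<le> x \<and> z \<le> w \<or> x \<le> z \<and> w \<le> z"
    using interior_common_bound[OF assms] .
  then have "w = z \<or> (w, z) \<in> parcs G" "z = w \<or> (z, w) \<in> parcs G"
    "x = z \<or> (x, z) \<in> parcs G" "z = x \<or> (z, x) \<in> parcs G"
    using assms interior_proper by (auto simp: G_simps order.strict_iff_order)
  then show "graph_dist G x w \<le> 2" "graph_dist G w x \<le> 2"
    using assms interior_proper G_simps(1) by (metis G.graph_dist_le_two)+
qed

text \<open>Incomparable vertices are not adjacent, hence at distance at least two. Distances from
  \<open>u\<close> to neighbours of \<open>v\<close> are at most two because \<open>u\<close> is
  interior; for those from \<open>v\<close> to neighbours of \<open>u\<close>, \<open>nbrs\<close>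
  makes one of the two ends interior.\<close>

lemma mmdI:
  assumes u: "u \<in> interior" and v: "v \<in> proper" and "\<not> u \<le> v" "\<not> v \<le> u"
    and nbrs: "v \<in> interior \<or> (\<forall>w\<in>proper. w < u \<or> u < w \<longrightarrow> w \<in> interior)"
  shows "(u, v) \<in> mmd" "(v, u) \<in> mmd"
proof -
  have ge: "2 \<le> graph_dist G u v" "2 \<le> graph_dist G v u"
    using assms(3,4) by (intro G.graph_dist_ge_two; auto simp: G_simps)+
  have le: "graph_dist G u w \<le> 2" if "w \<in> open_nbhd G v" for w
    using that interior_dist_le_two[OF u] by (auto simp: open_nbhd_def G_simps)
  have le': "graph_dist G v w \<le> 2" if "w \<in> open_nbhd G u" for w
    using that interior_dist_le_two v nbrs by (auto simp: open_nbhd_def G_simps)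
  have "mutually_maximally_distant G u v" "mutually_maximally_distant G v u"
    using assms interior_proper[OF u] order_trans[OF le ge(1)] order_trans[OF le ge(2)]
      order_trans[OF le' ge(1)] order_trans[OF le' ge(2)]
    by (auto simp: mutually_maximally_distant_def G_simps)
  then show "(u, v) \<in> mmd" "(v, u) \<in> mmd"
    by auto
qed

lemma interior_mmdI:
  assumes "x \<in> interior" "y \<in> interior" "i \<in> A" "coord x i < coord y i" "j \<in> A" "coord y j < coord x j"
  shows "(x, y) \<in> mmd"
proof -
  have "x \<in> L" "y \<in> L"
    using assms by (auto simp: interior_def)
  then have "\<not> x \<le> y" "\<not> y \<le> x"
    using assms not_leI by blast+
  then show ?thesis
    using assms interior_proper by (intro mmdI) auto
qed

lemma mid_mmd:
  assumes h: "h \<in> L" "\<forall>i\<in>A. coord h i = mid i" and b: "b \<in> proper" "b \<notin> interior"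
  shows "(b, h) \<in> mmd"
proof (rule mmdI(2))
  \<comment> \<open>All coordinates of \<open>b\<close> are extremal, and both values occur because
    \<open>b\<close> is proper. The bottom one at \<open>i\<close> prevents
    \<open>h \<le> b\<close>, the top one at \<open>j\<close> prevents
    \<open>b \<le> h\<close>.\<close>
  obtain i j where i: "i \<in> A" "coord b i \<noteq> hi i" and j: "j \<in> A" "coord b j \<noteq> lo j" and L: "b \<in> L"
    using b(1) by (auto simp: proper_def)
  then have *: "coord b i = lo i" "coord b j = hi j"
    using b(2) interiorI by auto
  show "h \<in> interior"
    using i(1) h lo_mid[OF i(1)] mid_hi[OF i(1)] by (auto simp: interior_def)
  show "\<not> h \<le> b" "\<not> b \<le> h"
    using * i j h L lo_mid mid_hi not_leI[of b h i] not_leI[of h b j] by auto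
  \<comment> \<open>A proper \<open>w\<close> below \<open>h\<close> has a coordinate different from
    \<open>lo\<close>; it is at most \<open>mid\<close>, hence below \<open>hi\<close>. The case
    above \<open>h\<close> is dual.\<close>
  have "w \<in> interior" if w: "w \<in> proper" and "w < h \<or> h < w" for w
    using that(2)
  proof
    assume "w < h"
    obtain k where k: "k \<in> A" "coord w k \<noteq> lo k"
      using w by (auto simp: proper_def)
    have "coord w k \<le> mid k"
      using \<open>w < h\<close> k h le_iff[OF proper_L[OF w] h(1)] by (auto dest!: less_imp_le)
    then show ?thesis
      using k mid_hi[OF k(1)] w by (intro interiorI[of _ k]) (auto simp: proper_L)
  next
    assume "h < w"
    obtain k where k: "k \<in> A" "coord w k \<noteq> hi k"
      using w by (auto simp: proper_def)
    have "mid k \<le> coord w k"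
      using \<open>h < w\<close> k h le_iff[OF h(1) proper_L[OF w]] by (auto dest!: less_imp_le)
    then show ?thesis
      using k lo_mid[OF k(1)] w by (intro interiorI[of _ k]) (auto simp: proper_L)
  qed
  then show "b \<in> interior \<or> (\<forall>w\<in>proper. w < h \<or> h < w \<longrightarrow> w \<in> interior)"
    by blast
qed (fact b)

section \<open>Paths of incomparable interior elements\<close>

lemma interior_reaches_mid_three:
  assumes three: "\<And>p q. p \<in> A \<Longrightarrow> q \<in> A \<Longrightarrow> \<exists>l\<in>A. l \<noteq> p \<and> l \<noteq> q"
    and h: "h \<in> L" "\<forall>i\<in>A. coord h i = mid i" and x: "x \<in> interior"
  shows "(x, h) \<in> mmd\<^sup>*"
proof -
  obtain i where i: "i \<in> A" "lo i < coord x i" "coord x i < hi i" and xL: "x \<in> L"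
    using x by (auto simp: interior_def)
  obtain j where j: "j \<in> A" "j \<noteq> i"
    using three[OF i(1) i(1)] by auto
  have hI: "h \<in> interior"
    using i(1) h lo_mid[OF i(1)] mid_hi[OF i(1)] by (auto simp: interior_def)
  \<comment> \<open>The third coordinate, kept at \<open>mid\<close>, is what makes this element interior.\<close>
  have y: "\<exists>y\<in>interior. coord y p = lo p \<and> coord y q = hi q \<and> (y, h) \<in> mmd"
    if pq: "p \<in> A" "q \<in> A" "p \<noteq> q" for p q
  proof -
    have "\<exists>y\<in>L. \<forall>j\<in>A. coord y j = (mid(p := lo p, q := hi q)) j"
      using lo_mem hi_mem mid_mem by (intro coord_surj) auto
    then obtain y where y: "y \<in> L" "\<forall>j\<in>A. coord y j = (mid(p := lo p, q := hi q)) j"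
      by blast
    obtain l where l: "l \<in> A" "l \<noteq> p" "l \<noteq> q"
      using three[OF pq(1,2)] by auto
    have yI: "y \<in> interior"
      using l y lo_mid[OF l(1)] mid_hi[OF l(1)] by (intro interiorI[of _ l]) auto
    have "(y, h) \<in> mmd"
      using pq y h lo_mid[OF pq(1)] mid_hi[OF pq(2)] by (intro interior_mmdI[OF yI hI pq(1) _ pq(2)]) auto
    moreover have "coord y p = lo p" "coord y q = hi q"
      using y pq by auto
    ultimately show ?thesis
      using yI by blast
  qed
  \<comment> \<open>Two steps suffice. If \<open>x\<close> is top at \<open>j\<close>, then
    \<open>y\<close> is bottom at \<open>j\<close> and top at \<open>i\<close>; otherwise
    \<open>y\<close> is top at \<open>j\<close> and bottom at \<open>i\<close>. Since
    \<open>x\<close> is strictly between the extremes at \<open>i\<close>, both choices are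
    incomparable to \<open>x\<close>.\<close>
  have "\<exists>y. (x, y) \<in> mmd \<and> (y, h) \<in> mmd"
  proof (cases "coord x j = hi j")
    case True
    obtain y where "y \<in> interior" "coord y j = lo j" "coord y i = hi i" "(y, h) \<in> mmd"
      using y[OF j(1) i(1) j(2)] by auto
    then show ?thesis
      using interior_mmdI[OF x, of y i j] i j True lo_less_hi by auto
  next
    case False
    obtain y where "y \<in> interior" "coord y i = lo i" "coord y j = hi j" "(y, h) \<in> mmd"
      using y[OF i(1) j(1)] j(2) by auto
    then show ?thesis
      using interior_mmdI[OF x, of y j i] i j less_hi[OF xL j(1) False] by auto
  qed
  then show ?thesis
    by (meson converse_rtrancl_into_rtrancl r_into_rtrancl)
qed

text \<open>The hub is \<open>e = (a, hi)\<close>, and \<open>f = (b, lo)\<close> is incomparable to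
  it because \<open>a < b\<close>. An interior element comparable to both is connected through
  \<open>f' = (lo, mid)\<close> or \<open>e' = (hi, mid)\<close>. Only chain \<open>i\<close> has to
  contain two intermediate elements; in chain \<open>j\<close> just \<open>mid\<close> is
  used.\<close>

lemma interior_reaches_interior_two:
  assumes A: "A = {i, j}" "i \<noteq> j"
    and ab: "a \<in> C i" "b \<in> C i" "lo i < a" "a < b" "b < hi i"
    and x: "x \<in> interior" and y: "y \<in> interior"
  shows "(x, y) \<in> mmd\<^sup>*"
proof -
  have ex: "\<exists>z\<in>L. coord z i = p \<and> coord z j = q" if "p \<in> C i" "q \<in> C j" for p q
  proof -
    have "\<exists>z\<in>L. \<forall>k\<in>A. coord z k = ((\<lambda>_. q)(i := p)) k"
      using that A by (intro coord_surj) auto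
    then show ?thesis
      using A by fastforce
  qed
  have ij: "i \<in> A" "j \<in> A"
    using A by auto
  note [simp] = ij
  have order: "a < hi i" "lo i < b" "lo j < hi j" "lo j < mid j" "mid j < hi j"
    using ab lo_mid[of j] mid_hi[of j] lo_less_hi[of j] by auto
  obtain e where e: "e \<in> L" "coord e i = a" "coord e j = hi j"
    using ex[of a "hi j"] ab hi_mem by auto
  obtain f where f: "f \<in> L" "coord f i = b" "coord f j = lo j"
    using ex[of b "lo j"] ab lo_mem by auto
  obtain e' where e': "e' \<in> L" "coord e' i = hi i" "coord e' j = mid j"
    using ex[of "hi i" "mid j"] hi_mem mid_mem by auto
  obtain f' where f': "f' \<in> L" "coord f' i = lo i" "coord f' j = mid j"
    using ex[of "lo i" "mid j"] lo_mem mid_mem by auto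
  have int: "e \<in> interior" "f \<in> interior" "e' \<in> interior" "f' \<in> interior"
    using e f e' f' ab order interiorI[of e i] interiorI[of f i] interiorI[of e' j] interiorI[of f' j]
    by auto
  have fe: "(f, e) \<in> mmd"
    using e f ab order by (intro interior_mmdI[of _ _ j i] int) auto
  have *: "(z, e) \<in> mmd\<^sup>*" if z: "z \<in> interior" for z
  proof -
    have zL: "z \<in> L"
      using z by (simp add: interior_def)
    have cmp: "p \<le> coord z i \<or> coord z i < p" "p < coord z i \<or> coord z i \<le> p" if "p \<in> C i" for p
      using total[OF ij(1) that coord_mem[OF zL ij(1)]] by (auto simp: order.strict_iff_order)
    \<comment> \<open>In the first two cases \<open>z\<close> is incomparable to \<open>e\<close> or
      to \<open>f\<close>. The last two are what remains: there \<open>z\<close> lies below both or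
      above both, its coordinate \<open>j\<close> is extremal, and so its coordinate
      \<open>i\<close> is strictly between the extremes.\<close>
    consider "a < coord z i" "coord z j \<noteq> hi j" | "coord z i < b" "coord z j \<noteq> lo j"
      | "coord z i \<le> a" "coord z j = lo j" | "b \<le> coord z i" "coord z j = hi j"
      using cmp(2)[OF ab(1)] cmp(1)[OF ab(2)] le_less_trans[OF _ ab(4), of "coord z i"] order(3)
      by (metis less_irrefl)
    then show ?thesis
    proof cases
      case 1
      then have "(z, e) \<in> mmd"
        using less_hi[OF zL] e by (intro interior_mmdI[of _ _ j i] int z) auto
      then show ?thesis by blast
    next
      case 2
      then have "(z, f) \<in> mmd"
        using lo_less[OF zL] f by (intro interior_mmdI[of _ _ i j] int z) auto
      then show ?thesis using fe by (meson converse_rtrancl_into_rtrancl r_into_rtrancl)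
    next
      case 3
      then have "lo i < coord z i"
        using z[unfolded interior_def] A by auto
      then have "(z, f') \<in> mmd"
        using 3 f' order by (intro interior_mmdI[of _ _ j i] int z) auto
      moreover have "(f', f) \<in> mmd"
        using f f' order by (intro interior_mmdI[of _ _ i j] int z) auto
      ultimately show ?thesis using fe by (meson converse_rtrancl_into_rtrancl r_into_rtrancl)
    next
      case 4
      then have "coord z i < hi i"
        using z[unfolded interior_def] A by auto
      then have "(z, e') \<in> mmd"
        using 4 e' order by (intro interior_mmdI[of _ _ i j] int z) auto
      moreover have "(e', e) \<in> mmd"
        using e e' order by (intro interior_mmdI[of _ _ j i] int z) auto
      ultimately show ?thesis by (meson converse_rtrancl_into_rtrancl r_into_rtrancl)
    qed
  qed
  have "sym mmd"
    by (auto intro: symI)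
  then show ?thesis
    using *[OF x] *[OF y] by (meson rtrancl_trans sym_rtrancl symD)
qed

text \<open>Given two distinct indices, \<open>big\<close> fails exactly for a product of two
  three-element chains, which is the excluded case of two factors with one nontrivial ideal
  each.\<close>

lemma strong_resolving_graph_connected:
  assumes two: "p \<in> A" "q \<in> A" "p \<noteq> q"
    and big: "(\<exists>l\<in>A. l \<noteq> p \<and> l \<noteq> q) \<or> (\<exists>i\<in>A. \<exists>a\<in>C i. \<exists>b\<in>C i. lo i < a \<and> a < b \<and> b < hi i)"
  shows "Digraph_Component.connected (with_proj (strong_resolving_graph G))"
proof -
  obtain h where h: "h \<in> L" "\<forall>i\<in>A. coord h i = mid i"
    using coord_surj[of mid] mid_mem by auto
  have hI: "h \<in> interior"
    using two(1) h lo_mid[OF two(1)] mid_hi[OF two(1)] by (auto simp: interior_def)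
  have reach: "(x, h) \<in> mmd\<^sup>*" if x: "x \<in> interior" for x
  proof (cases "\<exists>l\<in>A. l \<noteq> p \<and> l \<noteq> q")
    case True
    then show ?thesis
      using two by (intro interior_reaches_mid_three[OF _ h x]) metis
  next
    case False
    then obtain i a b where i: "i \<in> A" "a \<in> C i" "b \<in> C i" "lo i < a" "a < b" "b < hi i"
      using big by auto
    define j where "j = (if i = p then q else p)"
    have "A = {i, j}" "i \<noteq> j"
      using False two i(1) by (auto simp: j_def)
    then show ?thesis
      using interior_reaches_interior_two i x hI by blast
  qed
  \<comment> \<open>A proper element with only extremal coordinates. As a partner of
    \<open>h\<close> it shows that \<open>h\<close> is a vertex of the strong resolving
    graph.\<close>
  have "\<exists>b\<in>L. \<forall>j\<in>A. coord b j = (lo(p := hi p)) j"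
    using lo_mem hi_mem by (intro coord_surj) auto
  then obtain b where b: "b \<in> L" "\<forall>j\<in>A. coord b j = (lo(p := hi p)) j"
    by blast
  have "b \<in> proper" "b \<notin> interior"
    using b two lo_less_hi[OF two(1)] lo_less_hi[OF two(2)] by (auto simp: proper_def interior_def split: if_splits)
  then have bh: "(b, h) \<in> mmd"
    by (rule mid_mmd[OF h])
  show ?thesis
  proof (rule connectedI[of h _ mmd])
    show "h \<in> pverts (strong_resolving_graph G)"
      using bh by (auto simp: strong_resolving_graph_def mutually_maximally_distant_def)
    show "(x, h) \<in> mmd\<^sup>*" if "x \<in> pverts (strong_resolving_graph G)" for x
      using that mid_mmd[OF h, of x] reach[of x] by (auto simp: strong_resolving_graph_def G_simps)
    show "(x, y) \<in> parcs (strong_resolving_graph G) \<and> x \<in> pverts (strong_resolving_graph G)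
        \<and> y \<in> pverts (strong_resolving_graph G)" if "(x, y) \<in> mmd" for x y
      using that by (auto simp: strong_resolving_graph_def mutually_maximally_distant_def)
  qed
qed

end

section \<open>Ideals of local Artinian principal ideal rings\<close>

text \<open>Zorn's lemma for the ideals that contain \<open>I\<close> and avoid
  \<open>\<one>\<close>. A maximal one among them is a maximal ideal, because an ideal containing
  \<open>\<one>\<close> is the whole ring.\<close>

lemma (in cring) ideal_subset_maximalideal:
  assumes I: "ideal I R" "\<one> \<notin> I"
  obtains M where "maximalideal M R" "I \<subseteq> M"
proof -
  define \<I> where "\<I> = {J. ideal J R \<and> I \<subseteq> J \<and> \<one> \<notin> J}"
  have "\<exists>M\<in>\<I>. \<forall>J\<in>\<I>. M \<subseteq> J \<longrightarrow> J = M"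
  proof (rule subset_Zorn_nonempty)
    show "\<I> \<noteq> {}"
      using I by (auto simp: \<I>_def)
    fix C assume C: "C \<noteq> {}" "subset.chain \<I> C"
    then have "subset.chain {J. ideal J R} C"
      by (auto simp: subset_chain_def \<I>_def)
    then have "ideal (\<Union>C) R"
      using chain_Union_is_ideal[of C] C(1) by simp
    moreover have C': "I \<subseteq> J" "\<one> \<notin> J" if "J \<in> C" for J
      using that C(2) by (auto simp: subset_chain_def \<I>_def)
    moreover have "I \<subseteq> \<Union>C"
      using C(1) C'(1) by (metis Union_upper equals0I order_trans)
    ultimately show "\<Union>C \<in> \<I>"
      unfolding \<I>_def by simp
  qed
  then obtain M where "M \<in> \<I>" and max: "\<And>J. J \<in> \<I> \<Longrightarrow> M \<subseteq> J \<Longrightarrow> J = M"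
    by blast
  then have M: "ideal M R" "I \<subseteq> M" "\<one> \<notin> M"
    by (simp_all add: \<I>_def)
  have "maximalideal M R"
  proof (rule maximalidealI)
    show "carrier R \<noteq> M"
      using M(3) by auto
    show "J = M \<or> J = carrier R" if "ideal J R" "M \<subseteq> J" for J
    proof (cases "\<one> \<in> J")
      case True
      then show ?thesis
        using ideal.one_imp_carrier that(1) by blast
    next
      case False
      then show ?thesis
        using that M(2) max[of J] by (auto simp: \<I>_def)
    qed
  qed (fact M)
  then show thesis
    using that M(2) by blast
qed

lemma (in cring) cgenideal_iff: "a \<in> PIdl b \<longleftrightarrow> (\<exists>x\<in>carrier R. a = x \<otimes> b)"
  by (auto simp: cgenideal_def)

section \<open>The generator of the maximal ideal and total comparability of ideals\<close>

context local_artinian_principal_ideal_ring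
begin

definition the_maximal :: "'a set" where
  "the_maximal = (THE M. maximalideal M R)"

lemma the_maximal: "maximalideal the_maximal R"
  unfolding the_maximal_def by (rule theI'[OF unique_maximalideal])

lemma maximalideal_eq: "maximalideal M R \<Longrightarrow> M = the_maximal"
  using unique_maximalideal the_maximal by blast

lemma one_notin_the_maximal: "\<one> \<notin> the_maximal"
  using the_maximal ideal.one_imp_carrier[of the_maximal R]
  by (auto simp: maximalideal_def maximalideal_axioms_def)

text \<open>Otherwise \<open>PIdl a\<close> would lie in some maximal ideal, and there is only
  one.\<close>

lemma unit_if_notin_the_maximal:
  assumes "a \<in> carrier R" "a \<notin> the_maximal"
  shows "a \<in> Units R"
proof -
  have "\<one> \<in> PIdl a"
  proof (rule ccontr)
    assume "\<one> \<notin> PIdl a"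
    then obtain M where "maximalideal M R" "PIdl a \<subseteq> M"
      using ideal_subset_maximalideal cgenideal_ideal[OF assms(1)] by blast
    then show False
      using maximalideal_eq cgenideal_self[OF assms(1)] assms(2) by blast
  qed
  then obtain x where "x \<in> carrier R" "\<one> = x \<otimes> a"
    by (auto simp: cgenideal_iff)
  then show ?thesis
    using assms(1) by (auto simp: Units_def m_comm intro!: bexI[of _ x])
qed

lemma the_maximal_generator: "\<exists>t\<in>carrier R. the_maximal = PIdl t"
proof -
  have "principalideal the_maximal R"
    using the_maximal ideal_principal by (simp add: maximalideal_def)
  then show ?thesis
    by (auto simp: principalideal_def principalideal_axioms_def cgenideal_eq_genideal)
qed

text \<open>The descending chain of the ideals generated by the powers of \<open>t\<close>
  stabilises, which gives \<open>t^N = x t^(N+1)\<close> for some \<open>x\<close>. The rest is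
  Nakayama's argument for a principal ideal.\<close>

lemma the_maximal_generator_nilpotent:
  assumes t: "t \<in> carrier R" "the_maximal = PIdl t"
  shows "\<exists>n::nat. t [^] n = \<zero>"
proof -
  have "PIdl (t [^] Suc n) \<subseteq> PIdl (t [^] n)" for n :: nat
    using t(1) by (intro cgenideal_minimal cgenideal_ideal) (auto simp: cgenideal_iff m_comm)
  then obtain N :: nat where "\<forall>n\<ge>N. PIdl (t [^] n) = PIdl (t [^] N)"
    using descending_chain_condition[of "\<lambda>n. PIdl (t [^] n)"] t(1) cgenideal_ideal by auto
  then have "t [^] N \<in> PIdl (t [^] Suc N)"
    using cgenideal_self[of "t [^] N"] t(1) by (metis le_SucI nat_pow_closed order_refl)
  then obtain x where x: "x \<in> carrier R" "t [^] N = x \<otimes> (t [^] N \<otimes> t)"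
    by (auto simp: cgenideal_iff)
  \<comment> \<open>\<open>1 - x t\<close> is a unit annihilating \<open>t\<^sup>N\<close>.\<close>
  have "\<one> \<ominus> x \<otimes> t \<notin> the_maximal"
  proof
    assume *: "\<one> \<ominus> x \<otimes> t \<in> the_maximal"
    interpret M: maximalideal the_maximal R by (rule the_maximal)
    have "x \<otimes> t \<in> the_maximal"
      using x t by (auto simp: cgenideal_iff)
    then have "(\<one> \<ominus> x \<otimes> t) \<oplus> x \<otimes> t \<in> the_maximal"
      using * M.a_closed by blast
    moreover have "(\<one> \<ominus> x \<otimes> t) \<oplus> x \<otimes> t = \<one>"
      using x(1) t(1) by algebra
    ultimately show False
      using one_notin_the_maximal by simp
  qed
  then have u: "\<one> \<ominus> x \<otimes> t \<in> Units R"
    using x t unit_if_notin_the_maximal by simp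
  have "(\<one> \<ominus> x \<otimes> t) \<otimes> t [^] N = t [^] N \<ominus> x \<otimes> (t [^] N \<otimes> t)"
    using x(1) t(1) nat_pow_closed[OF t(1), of N] by algebra
  also have "\<dots> = \<zero>"
    using x(2)[symmetric] t(1) by simp
  finally have "(\<one> \<ominus> x \<otimes> t) \<otimes> t [^] N = (\<one> \<ominus> x \<otimes> t) \<otimes> \<zero>"
    using x(1) t(1) by simp
  then have "t [^] N = \<zero>"
    using u t(1) by (subst (asm) Units_l_cancel) auto
  then show ?thesis ..
qed

text \<open>Membership of \<open>a\<close> in \<open>PIdl (t [^] k)\<close> holds at exponent 0 and
  fails where the power vanishes, so it is lost at some step from \<open>k\<close> to
  \<open>Suc k\<close>. The cofactor at that \<open>k\<close> is not divisible by \<open>t\<close>,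
  hence a unit.\<close>

lemma unit_times_power:
  assumes t: "t \<in> carrier R" "the_maximal = PIdl t" and a: "a \<in> carrier R" "a \<noteq> \<zero>"
  obtains u and k :: nat where "u \<in> Units R" "a = u \<otimes> t [^] k"
proof -
  obtain n :: nat where "t [^] n = \<zero>"
    using the_maximal_generator_nilpotent[OF t] ..
  then have "a \<notin> PIdl (t [^] n)"
    using a by (auto simp: cgenideal_iff)
  moreover have "a \<in> PIdl (t [^] (0::nat))"
    using a by (auto simp: cgenideal_iff intro: bexI[of _ a])
  ultimately obtain k where k: "a \<in> PIdl (t [^] k)" "a \<notin> PIdl (t [^] Suc k)"
    by (induction n) blast+
  then obtain u where u: "u \<in> carrier R" "a = u \<otimes> t [^] k"
    by (auto simp: cgenideal_iff)
  have "u \<notin> the_maximal"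
  proof
    assume "u \<in> the_maximal"
    then obtain x where x: "x \<in> carrier R" "u = x \<otimes> t"
      using t by (auto simp: cgenideal_iff)
    then have "a = x \<otimes> t [^] Suc k"
      using u t(1) by (simp add: m_ac)
    then show False
      using k(2) x(1) cgenideal_iff by blast
  qed
  then show thesis
    using that unit_if_notin_the_maximal u by blast
qed

text \<open>Of two nonzero elements, the one with the larger exponent of \<open>t\<close> is a
  multiple of the other. Zero is treated apart, since \<open>unit_times_power\<close> covers nonzero
  elements only.\<close>

lemma PIdl_total:
  assumes "a \<in> carrier R" "b \<in> carrier R"
  shows "a \<in> PIdl b \<or> b \<in> PIdl a"
proof (cases "a = \<zero> \<or> b = \<zero>")
  case True
  then show ?thesis
    using assms by (auto simp: cgenideal_iff intro: bexI[of _ \<zero>])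
next
  case False
  obtain t where t: "t \<in> carrier R" "the_maximal = PIdl t"
    using the_maximal_generator by blast
  have *: "u \<otimes> t [^] k \<in> PIdl (v \<otimes> t [^] l)"
    if "u \<in> Units R" "v \<in> Units R" "l \<le> k" for u v and k l :: nat
  proof -
    have "t [^] k = t [^] (k - l) \<otimes> t [^] l"
      using t(1) \<open>l \<le> k\<close> by (simp add: nat_pow_mult)
    moreover have "(u \<otimes> inv v \<otimes> t [^] (k - l)) \<otimes> (v \<otimes> t [^] l) =
        (inv v \<otimes> v) \<otimes> (u \<otimes> (t [^] (k - l) \<otimes> t [^] l))"
      using that t(1) by (simp add: m_ac Units_closed del: Units_l_inv Units_r_inv)
    ultimately have "u \<otimes> t [^] k = (u \<otimes> inv v \<otimes> t [^] (k - l)) \<otimes> (v \<otimes> t [^] l)"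
      using that t(1) by (simp add: Units_closed)
    then show ?thesis
      using that t(1) unfolding cgenideal_iff
      by (intro bexI[of _ "u \<otimes> inv v \<otimes> t [^] (k - l)"]) auto
  qed
  obtain u k where u: "u \<in> Units R" "a = u \<otimes> t [^] (k::nat)"
    using unit_times_power[OF t assms(1)] False by blast
  obtain v l where v: "v \<in> Units R" "b = v \<otimes> t [^] (l::nat)"
    using unit_times_power[OF t assms(2)] False by blast
  show ?thesis
    using *[of u v l k] *[of v u k l] u v by (cases "l \<le> k") auto
qed

lemma ideals_total:
  assumes "ideal I R" "ideal J R"
  shows "I \<subseteq> J \<or> J \<subseteq> I"
proof (rule ccontr)
  assume "\<not> ?thesis"
  then obtain x y where xy: "x \<in> I" "x \<notin> J" "y \<in> J" "y \<notin> I"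
    by blast
  have "PIdl x \<subseteq> I" "PIdl y \<subseteq> J"
    using xy assms by (simp_all add: cgenideal_minimal)
  moreover have "x \<in> PIdl y \<or> y \<in> PIdl x"
    using xy assms by (intro PIdl_total) (simp_all add: ideal.Icarr)
  ultimately show False
    using xy by auto
qed

text \<open>A nonzero commutative ring whose only ideals are zero and itself is a field.\<close>

lemma nontrivial_ideals_nonempty:
  assumes "\<not> field R"
  shows "nontrivial_ideals R \<noteq> {}"
proof
  assume "nontrivial_ideals R = {}"
  then have "{I. ideal I R} = {{\<zero>}, carrier R}"
    using zeroideal oneideal by (auto simp: nontrivial_ideals_def)
  moreover have "carrier R \<noteq> {\<zero>}"
    using one_notin_the_maximal additive_subgroup.zero_closed[OF ideal.axioms(1)] the_maximal
    by (metis maximalideal_def one_closed singletonD)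
  ultimately show False
    using trivialideals_fieldI assms by blast
qed

text \<open>The cardinality serves only to exclude a singleton, so the value 0 that
  \<open>card\<close> takes on infinite sets does no harm.\<close>

lemma nontrivial_ideals_strict_chain:
  assumes "\<not> field R" "card (nontrivial_ideals R) \<noteq> 1"
  obtains I J where "I \<in> nontrivial_ideals R" "J \<in> nontrivial_ideals R" "I \<subset> J"
proof -
  obtain I where I: "I \<in> nontrivial_ideals R"
    using nontrivial_ideals_nonempty assms(1) by blast
  moreover have "nontrivial_ideals R \<noteq> {I}"
    using assms(2) by auto
  ultimately obtain J where J: "J \<in> nontrivial_ideals R" "J \<noteq> I"
    by blast
  then have "I \<subseteq> J \<or> J \<subseteq> I"
    using I ideals_total by (simp add: nontrivial_ideals_def)
  then show thesis
    using that I J by blast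
qed

end

lemma nontrivial_ideal_strict_bounds:
  assumes "I \<in> nontrivial_ideals R"
  shows "{\<zero>\<^bsub>R\<^esub>} \<subset> I" "I \<subset> carrier R"
proof -
  have I: "additive_subgroup I R" "I \<noteq> {\<zero>\<^bsub>R\<^esub>}" "I \<noteq> carrier R"
    using assms ideal.axioms(1) by (auto simp: nontrivial_ideals_def)
  show "{\<zero>\<^bsub>R\<^esub>} \<subset> I" "I \<subset> carrier R"
    using I additive_subgroup.zero_closed[OF I(1)] additive_subgroup.a_subset[OF I(1)] by blast+
qed

section \<open>Ideals of a finite product\<close>

lemma RDirProd_list_nth_hom:
  "i < length Rs \<Longrightarrow> (\<lambda>as. as ! i) \<in> ring_hom (RDirProd_list Rs) (Rs ! i)"
proof (induction Rs arbitrary: i)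
  case (Cons S Ss)
  let ?P = "RDirProd_list (S # Ss)" and ?Q = "RDirProd_list Ss"
  have cons: "(\<lambda>(a, as). a # as) \<in> ring_hom (RDirProd S ?Q) ?P"
    by (rule RDirProd_list_hom1)
  have split: "\<exists>b bs. as = b # bs \<and> b \<in> carrier S \<and> bs \<in> carrier ?Q" if "as \<in> carrier ?P" for as
    using that by (auto simp: RDirProd_list_carrier)
  \<comment> \<open>The operations on nonempty lists are read off from the homomorphism
    \<open>cons\<close> on the binary product.\<close>
  have ops: "(a # as) \<otimes>\<^bsub>?P\<^esub> (b # bs) = (a \<otimes>\<^bsub>S\<^esub> b) # (as \<otimes>\<^bsub>?Q\<^esub> bs)"
    "(a # as) \<oplus>\<^bsub>?P\<^esub> (b # bs) = (a \<oplus>\<^bsub>S\<^esub> b) # (as \<oplus>\<^bsub>?Q\<^esub> bs)"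
    if "a \<in> carrier S" "b \<in> carrier S" "as \<in> carrier ?Q" "bs \<in> carrier ?Q" for a b as bs
    using ring_hom_mult[OF cons, of "(a, as)" "(b, bs)"] ring_hom_add[OF cons, of "(a, as)" "(b, bs)"] that
    by (simp_all add: RDirProd_carrier RDirProd_def DirProd_def monoid.defs)
  have one: "\<one>\<^bsub>?P\<^esub> = \<one>\<^bsub>S\<^esub> # \<one>\<^bsub>?Q\<^esub>"
    by (simp add: RDirProd_list_one)
  show ?case
  proof (rule ring_hom_memI)
    show "as ! i \<in> carrier ((S # Ss) ! i)" if "as \<in> carrier ?P" for as
      using RDirProd_list_carrier_mem(2)[OF that] Cons.prems by blast
    show "\<one>\<^bsub>?P\<^esub> ! i = \<one>\<^bsub>(S # Ss) ! i\<^esub>"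
      using Cons one ring_hom_one by (cases i) fastforce+
    fix as bs assume "as \<in> carrier ?P" "bs \<in> carrier ?P"
    then obtain c cs d ds where *: "as = c # cs" "bs = d # ds" "c \<in> carrier S" "d \<in> carrier S"
      "cs \<in> carrier ?Q" "ds \<in> carrier ?Q"
      using split by meson
    show "(as \<otimes>\<^bsub>?P\<^esub> bs) ! i = as ! i \<otimes>\<^bsub>(S # Ss) ! i\<^esub> bs ! i"
      "(as \<oplus>\<^bsub>?P\<^esub> bs) ! i = as ! i \<oplus>\<^bsub>(S # Ss) ! i\<^esub> bs ! i"
      using Cons.prems * ring_hom_mult[OF Cons.IH *(5,6)] ring_hom_add[OF Cons.IH *(5,6)]
      by (cases i; simp add: ops)+
  qed
qed simp

text \<open>A finite direct product described by its projections: jointly injective and jointly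
  surjective homomorphisms. Ideals of \<open>R\<close> can then be studied in place, without being
  transported along an isomorphism.\<close>

locale ring_product = ring R for R :: "('a, 'm) ring_scheme" (structure) +
  fixes A :: "'i set" and S :: "'i \<Rightarrow> ('b, 'n) ring_scheme" and p :: "'i \<Rightarrow> 'a \<Rightarrow> 'b"
  assumes finite_A: "finite A"
    and ring_factor: "i \<in> A \<Longrightarrow> ring (S i)"
    and proj_hom: "i \<in> A \<Longrightarrow> p i \<in> ring_hom R (S i)"
    and proj_surj: "(\<And>i. i \<in> A \<Longrightarrow> f i \<in> carrier (S i)) \<Longrightarrow> \<exists>x\<in>carrier R. \<forall>i\<in>A. p i x = f i"
    and proj_inj: "x \<in> carrier R \<Longrightarrow> y \<in> carrier R \<Longrightarrow> (\<And>i. i \<in> A \<Longrightarrow> p i x = p i y) \<Longrightarrow> x = y"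
begin

lemma proj_hom_ring: "i \<in> A \<Longrightarrow> ring_hom_ring R (S i) (p i)"
  using proj_hom ring_factor ring_axioms by (simp add: ring_hom_ring_def ring_hom_ring_axioms_def)

lemma proj_zero: "i \<in> A \<Longrightarrow> p i \<zero> = \<zero>\<^bsub>S i\<^esub>"
  by (intro ring_hom_zero[OF proj_hom ring_axioms] ring_factor)

lemma proj_a_inv: "i \<in> A \<Longrightarrow> x \<in> carrier R \<Longrightarrow> p i (\<ominus> x) = \<ominus>\<^bsub>S i\<^esub> p i x"
proof -
  assume i: "i \<in> A" and x: "x \<in> carrier R"
  interpret h: ring_hom_ring R "S i" "p i" by (rule proj_hom_ring[OF i])
  show "p i (\<ominus> x) = \<ominus>\<^bsub>S i\<^esub> p i x"
    using x by simp
qed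

text \<open>Taking \<open>k\<close> to be one gives the idempotent of factor \<open>i\<close>;
  arbitrary \<open>k\<close> serves to lift elements of a factor.\<close>

lemma indicator_elem:
  assumes i: "i \<in> A" and "k \<in> carrier (S i)"
  obtains x where "x \<in> carrier R" "p i x = k" "\<And>j. j \<in> A \<Longrightarrow> j \<noteq> i \<Longrightarrow> p j x = \<zero>\<^bsub>S j\<^esub>"
proof -
  have "(if j = i then k else \<zero>\<^bsub>S j\<^esub>) \<in> carrier (S j)" if "j \<in> A" for j
    using assms that ring.ring_simprules(2)[OF ring_factor] by auto
  then show thesis
    using proj_surj[of "\<lambda>j. if j = i then k else \<zero>\<^bsub>S j\<^esub>"] that i by force
qed

lemma proj_carrier: "i \<in> A \<Longrightarrow> p i ` carrier R = carrier (S i)"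
proof
  assume i: "i \<in> A"
  show "p i ` carrier R \<subseteq> carrier (S i)"
    using ring_hom_closed[OF proj_hom[OF i]] by auto
  show "carrier (S i) \<subseteq> p i ` carrier R"
    using indicator_elem[OF i] by (metis image_eqI subsetI)
qed

lemma proj_ideal:
  assumes I: "ideal I R" and i: "i \<in> A"
  shows "ideal (p i ` I) (S i)"
proof -
  interpret I: ideal I R by fact
  interpret h: ring_hom_ring R "S i" "p i" by (rule proj_hom_ring[OF i])
  show ?thesis
  proof (rule idealI)
    show "subgroup (p i ` I) (add_monoid (S i))"
    proof (rule subgroup.intro)
      show "p i ` I \<subseteq> carrier (add_monoid (S i))"
        by (auto simp: I.Icarr)
      show "\<one>\<^bsub>add_monoid (S i)\<^esub> \<in> p i ` I"
        using imageI[OF I.zero_closed, of "p i"] by simp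
      fix a assume "a \<in> p i ` I"
      then obtain x where x: "x \<in> I" "a = p i x"
        by blast
      then have "\<ominus>\<^bsub>S i\<^esub> a \<in> p i ` I"
        using imageI[OF I.a_inv_closed[OF x(1)], of "p i"] by (simp add: I.Icarr)
      then show "inv\<^bsub>add_monoid (S i)\<^esub> a \<in> p i ` I"
        by (simp add: a_inv_def)
      fix b assume "b \<in> p i ` I"
      then obtain y where y: "y \<in> I" "b = p i y"
        by blast
      show "a \<otimes>\<^bsub>add_monoid (S i)\<^esub> b \<in> p i ` I"
        using imageI[OF I.a_closed[OF x(1) y(1)], of "p i"] x y by (simp add: I.Icarr)
    qed
    \<comment> \<open>Absorption relies on surjectivity of the projection: the multiplier
      \<open>x\<close> is lifted to \<open>R\<close>.\<close>
    fix a x assume a: "a \<in> p i ` I" and x: "x \<in> carrier (S i)"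
    then obtain b y where b: "b \<in> I" "a = p i b" and y: "y \<in> carrier R" "x = p i y"
      using proj_carrier[OF i] by blast
    show "x \<otimes>\<^bsub>S i\<^esub> a \<in> p i ` I" "a \<otimes>\<^bsub>S i\<^esub> x \<in> p i ` I"
      using imageI[OF I.I_l_closed[OF b(1) y(1)], of "p i"]
        imageI[OF I.I_r_closed[OF b(1) y(1)], of "p i"] b y by (simp_all add: I.Icarr)
  qed (rule h.S.ring_axioms)
qed

text \<open>An element of \<open>J\<close> with the coordinates of \<open>x\<close> is assembled one
  factor at a time: an element of \<open>J\<close> with the right coordinate \<open>i\<close> is
  multiplied by the idempotent of factor \<open>i\<close> and added. Finiteness of \<open>A\<close>
  enters here.\<close>

lemma mem_ideal_if_proj_mem:
  assumes J: "ideal J R" and x: "x \<in> carrier R" and mem: "\<And>i. i \<in> A \<Longrightarrow> p i x \<in> p i ` J"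
  shows "x \<in> J"
proof -
  interpret J: ideal J R by fact
  have "\<exists>z\<in>J. (\<forall>i\<in>B. p i z = p i x) \<and> (\<forall>i\<in>A - B. p i z = \<zero>\<^bsub>S i\<^esub>)" if "finite B" "B \<subseteq> A" for B
    using that
  proof (induction B rule: finite_induct)
    case empty
    then show ?case
      by (intro bexI[of _ \<zero>]) (auto simp: proj_zero)
  next
    case (insert i B)
    then have i: "i \<in> A"
      by simp
    obtain z where z: "z \<in> J" "\<forall>j\<in>B. p j z = p j x" "\<forall>j\<in>A - B. p j z = \<zero>\<^bsub>S j\<^esub>"
      using insert by auto
    obtain w where w: "w \<in> J" "p i w = p i x"
      using mem[OF i] by auto
    obtain e where e: "e \<in> carrier R" "p i e = \<one>\<^bsub>S i\<^esub>" "\<And>j. j \<in> A \<Longrightarrow> j \<noteq> i \<Longrightarrow> p j e = \<zero>\<^bsub>S j\<^esub>"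
      using indicator_elem[OF i ring.ring_simprules(6)[OF ring_factor[OF i]]] by blast
    \<comment> \<open>\<open>e\<close> removes all coordinates of \<open>w\<close> except
      \<open>i\<close>, and \<open>z\<close> is zero at \<open>i\<close> because \<open>i\<close> is
      not yet in \<open>B\<close>; so the sum changes coordinate \<open>i\<close> alone.\<close>
    have val: "p j (z \<oplus> e \<otimes> w) = (if j = i then p i x else p j z)" if j: "j \<in> A" for j
    proof -
      interpret h: ring_hom_ring R "S j" "p j" by (rule proj_hom_ring[OF j])
      have "p j (z \<oplus> e \<otimes> w) = p j z \<oplus>\<^bsub>S j\<^esub> p j e \<otimes>\<^bsub>S j\<^esub> p j w"
        using z w e by (simp add: J.Icarr)
      moreover have "p j z \<oplus>\<^bsub>S j\<^esub> p j e \<otimes>\<^bsub>S j\<^esub> p j w = (if j = i then p i x else p j z)"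
      proof (cases "j = i")
        case True
        then have "p j z = \<zero>\<^bsub>S j\<^esub>" "p j e = \<one>\<^bsub>S j\<^esub>" "p j w = p j x"
          using z w e i insert.hyps(2) by auto
        moreover have "p j x \<in> carrier (S j)"
          using x by simp
        ultimately show ?thesis
          using True h.S.l_zero h.S.l_one by metis
      next
        case False
        have "p j w \<in> carrier (S j)" "p j z \<in> carrier (S j)"
          using z w by (simp_all add: J.Icarr)
        then show ?thesis
          using False e(3)[OF j False] by simp
      qed
      ultimately show ?thesis
        by (rule trans)
    qed
    have "z \<oplus> e \<otimes> w \<in> J"
      using z(1) w(1) e(1) by (intro J.a_closed J.I_l_closed)
    moreover have "\<forall>j\<in>insert i B. p j (z \<oplus> e \<otimes> w) = p j x"
      using insert.prems val z(2) by (metis insertE subsetD)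
    moreover have "\<forall>j\<in>A - insert i B. p j (z \<oplus> e \<otimes> w) = \<zero>\<^bsub>S j\<^esub>"
    proof
      fix j assume "j \<in> A - insert i B"
      then show "p j (z \<oplus> e \<otimes> w) = \<zero>\<^bsub>S j\<^esub>"
        using val[of j] z(3) by auto
    qed
    ultimately show ?case
      by (intro bexI conjI)
  qed
  from this[OF finite_A] obtain z where z: "z \<in> J" "\<forall>i\<in>A. p i z = p i x"
    by auto
  then have "z = x"
    using x by (intro proj_inj) (auto simp: J.Icarr)
  then show ?thesis
    using z by simp
qed

lemma ideal_subset_iff:
  assumes "ideal I R" "ideal J R"
  shows "I \<subseteq> J \<longleftrightarrow> (\<forall>i\<in>A. p i ` I \<subseteq> p i ` J)"
proof
  assume *: "\<forall>i\<in>A. p i ` I \<subseteq> p i ` J"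
  show "I \<subseteq> J"
  proof
    fix x assume "x \<in> I"
    then show "x \<in> J"
      using * ideal.Icarr[OF assms(1)] by (intro mem_ideal_if_proj_mem[OF assms(2)]) auto
  qed
qed (simp add: image_mono)

lemma product_ideal:
  assumes K: "\<And>i. i \<in> A \<Longrightarrow> ideal (K i) (S i)"
  obtains I where "ideal I R" "\<And>i. i \<in> A \<Longrightarrow> p i ` I = K i"
proof
  let ?I = "{x \<in> carrier R. \<forall>i\<in>A. p i x \<in> K i}"
  note h = ring_hom_add[OF proj_hom] ring_hom_mult[OF proj_hom] ring_hom_closed[OF proj_hom]
    proj_zero proj_a_inv
  have k: "additive_subgroup (K i) (S i)" if "i \<in> A" for i
    by (rule ideal.axioms(1)[OF K[OF that]])
  show "ideal ?I R"
  proof (rule idealI)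
    show "subgroup ?I (add_monoid R)"
    proof (rule subgroup.intro)
      show "inv\<^bsub>add_monoid R\<^esub> x \<in> ?I" if "x \<in> ?I" for x
        using that by (auto simp: h additive_subgroup.a_inv_closed[OF k] abelian_group.a_inv_closed
          simp flip: a_inv_def)
    qed (auto simp: h additive_subgroup.a_closed[OF k] additive_subgroup.zero_closed[OF k])
  qed (auto simp: h ideal.I_l_closed[OF K] ideal.I_r_closed[OF K] ring_axioms)
  show "p i ` ?I = K i" if i: "i \<in> A" for i
  proof
    \<comment> \<open>A lift of \<open>a\<close> with zeros in all other factors lies in
      \<open>?I\<close>, since every \<open>K j\<close> contains zero.\<close>
    show "K i \<subseteq> p i ` ?I"
    proof
      fix a assume a: "a \<in> K i"
      then have "a \<in> carrier (S i)"
        using ideal.Icarr[OF K[OF i]] by blast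
      then obtain x where x: "x \<in> carrier R" "p i x = a" "\<And>j. j \<in> A \<Longrightarrow> j \<noteq> i \<Longrightarrow> p j x = \<zero>\<^bsub>S j\<^esub>"
        using indicator_elem[OF i] by blast
      then have "p j x \<in> K j" if "j \<in> A" for j
        using that a additive_subgroup.zero_closed[OF k[OF that]] by (cases "j = i") auto
      then show "a \<in> p i ` ?I"
        using x by blast
    qed
  qed (use i in auto)
qed

lemma zero_ideal_iff:
  assumes "ideal I R"
  shows "I = {\<zero>} \<longleftrightarrow> (\<forall>i\<in>A. p i ` I = {\<zero>\<^bsub>S i\<^esub>})"
proof
  assume "\<forall>i\<in>A. p i ` I = {\<zero>\<^bsub>S i\<^esub>}"
  then have "I \<subseteq> {\<zero>}"
    using ideal_subset_iff[OF assms zeroideal] by (simp add: proj_zero)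
  then show "I = {\<zero>}"
    using additive_subgroup.zero_closed[OF ideal.axioms(1)[OF assms]] by blast
qed (simp add: proj_zero)

lemma carrier_ideal_iff:
  assumes "ideal I R"
  shows "I = carrier R \<longleftrightarrow> (\<forall>i\<in>A. p i ` I = carrier (S i))"
proof
  assume "\<forall>i\<in>A. p i ` I = carrier (S i)"
  then have "carrier R \<subseteq> I"
    using ideal_subset_iff[OF oneideal assms] by (simp add: proj_carrier)
  then show "I = carrier R"
    using additive_subgroup.a_subset[OF ideal.axioms(1)[OF assms]] by blast
qed (simp add: proj_carrier)

end

lemma ring_product_of_iso:
  assumes R: "ring R" and Ss: "\<And>i. i < length Ss \<Longrightarrow> ring (Ss ! i)"
    and \<phi>: "\<phi> \<in> ring_iso R (RDirProd_list Ss)"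
  shows "ring_product R {..<length Ss} ((!) Ss) (\<lambda>i x. \<phi> x ! i)"
proof -
  have hom: "\<phi> \<in> ring_hom R (RDirProd_list Ss)" and bij: "bij_betw \<phi> (carrier R) (carrier (RDirProd_list Ss))"
    using \<phi> by (auto simp: ring_iso_def)
  show ?thesis
  proof (intro ring_product.intro ring_product_axioms.intro R)
    show "(\<lambda>x. \<phi> x ! i) \<in> ring_hom R (Ss ! i)" if "i \<in> {..<length Ss}" for i
      using ring_hom_trans[OF hom RDirProd_list_nth_hom[of i Ss]] that by (simp add: comp_def)
    show "\<exists>x\<in>carrier R. \<forall>i\<in>{..<length Ss}. \<phi> x ! i = f i"
      if "\<And>i. i \<in> {..<length Ss} \<Longrightarrow> f i \<in> carrier (Ss ! i)" for f
    proof -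
      have "map f [0..<length Ss] \<in> carrier (RDirProd_list Ss)"
        using that by (intro RDirProd_list_carrier_memI) auto
      then obtain x where "x \<in> carrier R" "\<phi> x = map f [0..<length Ss]"
        using bij by (metis bij_betw_imp_surj_on imageE)
      then show ?thesis
        by (intro bexI[of _ x]) auto
    qed
    show "x = y" if xy: "x \<in> carrier R" "y \<in> carrier R"
      and eq: "\<And>i. i \<in> {..<length Ss} \<Longrightarrow> \<phi> x ! i = \<phi> y ! i" for x y
    proof -
      have "\<phi> x \<in> carrier (RDirProd_list Ss)" "\<phi> y \<in> carrier (RDirProd_list Ss)"
        using xy bij by (auto dest: bij_betwE)
      then have "\<phi> x = \<phi> y"
        using eq by (intro nth_equalityI) (auto simp: RDirProd_list_carrier_mem(1))
      then show ?thesis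
        using xy bij by (metis bij_betw_imp_inj_on inj_onD)
    qed
  qed (auto simp: Ss)
qed

section \<open>The strong resolving graph of the inclusion ideal graph\<close>

theorem lemma3p4:
  fixes R :: "('a, 'm) ring_scheme"
    and S :: "nat \<Rightarrow> ('b, 'n) ring_scheme"
    and m :: nat
  assumes "m \<ge> 2"
    and "cring R"
    and "R \<simeq> RDirProd_list (map S [1..<Suc m])"
    and "\<And>i. 1 \<le> i \<Longrightarrow> i \<le> m \<Longrightarrow> local_artinian_principal_ideal_ring (S i)"
    and "\<And>i. 1 \<le> i \<Longrightarrow> i \<le> m \<Longrightarrow> \<not> field (S i)"
    and "\<not> (m = 2 \<and> card (nontrivial_ideals (S 1)) = 1 \<and> card (nontrivial_ideals (S 2)) = 1)"
  shows "Digraph_Component.connected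
           (with_proj (strong_resolving_graph (inclusion_ideal_graph R)))"
proof -
  define Ss where "Ss = map S [1..<Suc m]"
  have len: "length Ss = m"
    by (simp add: Ss_def)
  \<comment> \<open>List positions start at 0, whereas the factors are numbered from 1.\<close>
  have nth: "Ss ! i = S (Suc i)" if "i < m" for i
    using that unfolding Ss_def by (subst nth_map) (auto simp del: upt_Suc)
  have lap: "local_artinian_principal_ideal_ring (Ss ! i)" and not_field: "\<not> field (Ss ! i)"
    if "i < m" for i
    using assms(4,5)[of "Suc i"] that by (simp_all add: nth)
  have ring: "ring (Ss ! i)" if "i < m" for i
    using lap[OF that]
    by (simp add: local_artinian_principal_ideal_ring_def local_cring_def cring_def)
  obtain \<phi> where "\<phi> \<in> ring_iso R (RDirProd_list Ss)"
    using assms(3) by (auto simp: is_ring_iso_def Ss_def)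
  then interpret P: ring_product R "{..<m}" "(!) Ss" "\<lambda>i x. \<phi> x ! i"
    using ring_product_of_iso[of R Ss] cring.axioms(1)[OF assms(2)] ring len by simp
  define mid where "mid i = (SOME I. I \<in> nontrivial_ideals (Ss ! i))" for i
  have mid: "mid i \<in> nontrivial_ideals (Ss ! i)" if "i < m" for i
    using local_artinian_principal_ideal_ring.nontrivial_ideals_nonempty[OF lap not_field, OF that that]
    unfolding mid_def by (simp add: some_in_eq)
  interpret C: chain_product "{I. ideal I R}" "{..<m}" "\<lambda>i. {I. ideal I (Ss ! i)}"
    "\<lambda>i. {\<zero>\<^bsub>Ss ! i\<^esub>}" mid "\<lambda>i. carrier (Ss ! i)" "\<lambda>I i. (\<lambda>x. \<phi> x ! i) ` I"
  proof
    show "I \<subseteq> J \<or> J \<subseteq> I"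
      if "i \<in> {..<m}" "I \<in> {I. ideal I (Ss ! i)}" "J \<in> {I. ideal I (Ss ! i)}" for i I J
      using local_artinian_principal_ideal_ring.ideals_total[OF lap] that by simp
    show "I \<subseteq> J \<longleftrightarrow> (\<forall>i\<in>{..<m}. (\<lambda>x. \<phi> x ! i) ` I \<subseteq> (\<lambda>x. \<phi> x ! i) ` J)"
      if "I \<in> {I. ideal I R}" "J \<in> {I. ideal I R}" for I J
      using P.ideal_subset_iff that by simp
    show "\<exists>I\<in>{I. ideal I R}. \<forall>i\<in>{..<m}. (\<lambda>x. \<phi> x ! i) ` I = f i"
      if "\<And>i. i \<in> {..<m} \<Longrightarrow> f i \<in> {I. ideal I (Ss ! i)}" for f
      using P.product_ideal[of f] that by (metis mem_Collect_eq)
    show "{\<zero>\<^bsub>Ss ! i\<^esub>} \<subseteq> I" "I \<subseteq> carrier (Ss ! i)"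
      if "i \<in> {..<m}" "I \<in> {I. ideal I (Ss ! i)}" for i I
      using that additive_subgroup.zero_closed additive_subgroup.a_subset ideal.axioms(1) by blast+
    show "mid i \<in> {I. ideal I (Ss ! i)}" if "i \<in> {..<m}" for i
      using mid[of i] that by (simp add: nontrivial_ideals_def)
    show "{\<zero>\<^bsub>Ss ! i\<^esub>} \<subset> mid i" "mid i \<subset> carrier (Ss ! i)" if "i \<in> {..<m}" for i
      using nontrivial_ideal_strict_bounds[OF mid] that by simp_all
  qed (auto simp: P.proj_ideal ring ring.zeroideal ring.oneideal)
  \<comment> \<open>Bottom and top of the product of chains correspond to the zero ideal and to
    \<open>R\<close>, which are recognised by their projections.\<close>
  have "C.proper = nontrivial_ideals R"
  proof (rule Set.set_eqI)
    fix I
    show "I \<in> C.proper \<longleftrightarrow> I \<in> nontrivial_ideals R"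
      using P.zero_ideal_iff[of I] P.carrier_ideal_iff[of I]
      unfolding C.proper_def nontrivial_ideals_def mem_Collect_eq by blast
  qed
  then have graph: "inclusion_ideal_graph R = C.G"
    by (simp add: inclusion_ideal_graph_def comparability_graph_def)
  \<comment> \<open>For \<open>m > 2\<close> the index 2 is a third one. For \<open>m = 2\<close>
    the excluded case leaves a factor whose number of nontrivial ideals is not one, and there two of
    them are strictly nested.\<close>
  have big: "(\<exists>l\<in>{..<m}. l \<noteq> 0 \<and> l \<noteq> 1) \<or> (\<exists>i\<in>{..<m}. \<exists>I\<in>{I. ideal I (Ss ! i)}.
    \<exists>J\<in>{I. ideal I (Ss ! i)}. {\<zero>\<^bsub>Ss ! i\<^esub>} \<subset> I \<and> I \<subset> J \<and> J \<subset> carrier (Ss ! i))"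
  proof (cases "m = 2")
    case True
    have "card (nontrivial_ideals (Ss ! 0)) \<noteq> 1 \<or> card (nontrivial_ideals (Ss ! 1)) \<noteq> 1"
      using True assms(6) nth[of 0] nth[of 1] by (auto simp: numeral_2_eq_2)
    then obtain i where i: "i < m" "card (nontrivial_ideals (Ss ! i)) \<noteq> 1"
      using True by (metis one_less_numeral_iff semiring_norm(76) zero_less_numeral)
    obtain I J where IJ: "I \<in> nontrivial_ideals (Ss ! i)" "J \<in> nontrivial_ideals (Ss ! i)" "I \<subset> J"
      using local_artinian_principal_ideal_ring.nontrivial_ideals_strict_chain[OF lap not_field, OF i(1) i(1) i(2)] .
    have "ideal I (Ss ! i)" "ideal J (Ss ! i)"
      using IJ by (simp_all add: nontrivial_ideals_def)
    moreover have "{\<zero>\<^bsub>Ss ! i\<^esub>} \<subset> I" "J \<subset> carrier (Ss ! i)"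
      using nontrivial_ideal_strict_bounds[OF IJ(1)] nontrivial_ideal_strict_bounds[OF IJ(2)] by simp_all
    ultimately show ?thesis
      using i(1) IJ(3) by blast
  next
    case False
    then have "2 \<in> {..<m}"
      using assms(1) by simp
    then show ?thesis
      by (intro disjI1 bexI[of _ 2]) auto
  qed
  show ?thesis
    unfolding graph using assms(1) by (intro C.strong_resolving_graph_connected[OF _ _ _ big]) auto
qed

end
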